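(* Let $H_d^+$ be a discrete right Hamiltonian and let $H_d^-$ be the associated discrete left Hamiltonian (the Legendre transform of $H_d^+$). If $H_d^+$ is self-adjoint, i.e. $H_d^-=(H_d^+)^*$ (up to equivalence), then the one-step method $F^h_{H_d^+}$ generated by $H_d^+$ is self-adjoint, i.e. $F^h_{H_d^+}=(F^h_{H_d^+})^*$. Conversely, if the method $F^h_{H_d^+}$ generated by a discrete right Hamiltonian $H_d^+$ is self-adjoint, then $H_d^+$ is self-adjoint.
   Context: All objects depend on a time-step $h$ (positive or negative, with $|h|$ in the range where everything is defined) and are local, in coordinates $(q,p)$ on $T^*Q$. A discrete right Hamiltonian (Type II generating function) $H_d^+(q_0,p_1;h)$ generates the map $F^h_{H_d^+}:(q_0,p_0)\mapsto(q_1,p_1)$ defined implicitly by $q_1=D_2H_d^+(q_0,p_1;h)$, $p_0=D_1H_d^+(q_0,p_1;h)$. A discrete left Hamiltonian (Type III generating function) $H_d^-(p_0,q_1;h)$ generates the map $F^h_{H_d^-}:(q_0,p_0)\mapsto(q_1,p_1)$ defined implicitly by $q_0=-D_1H_d^-(p_0,q_1;h)$, $p_1=-D_2H_d^-(p_0,q_1;h)$. These relations are assumed to define the maps (locally), and the Legendre transform below is assumed to be defined. The discrete left Hamiltonian associated with $H_d^+$ (its Legendre transform) is $$H_d^-(p_0,q_1;h)=-p_0^Tq_0-p_1^Tq_1+H_d^+(q_0,p_1;h),$$ where $q_0,p_1$ are regarded as functions of $(p_0,q_1)$ through the relations $q_1=D_2H_d^+(q_0,p_1;h)$, $p_0=D_1H_d^+(q_0,p_1;h)$.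 The adjoint of a Type II generating function $H_d^+$ is the Type III generating function $$(H_d^+)^*(p_0,q_1;h)=-H_d^+(q_1,p_0;-h).$$ The adjoint of a one-step method $\Phi_h$ is $\Phi_h^*=\Phi_{-h}^{-1}$, and $\Phi_h$ is self-adjoint (symmetric) if $\Phi_h=\Phi_h^*$. Two Type III generating functions are equivalent if they generate the same map $(q_0,p_0)\mapsto(q_1,p_1)$. The discrete right Hamiltonian $H_d^+$ is self-adjoint if $(H_d^+)^*$ equals, up to equivalence, the associated discrete left Hamiltonian $H_d^-$. *)

theory Defs
  imports "HOL-Analysis.Analysis"
begin

text \<open>
  Everything lives in a coordinate chart of the cotangent bundle: positions and momenta are
  vectors of the same inner product space (covectors are identified with vectors, so that
  $p^T q$ is the inner product), and a phase point is a pair $(q,p)$.  A generating function takes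
  its two vector arguments in the order in which they are written, and the time step last; its
  domain is a set of argument pairs for each time step.  A local map is represented by
  its graph, with its domain being the domain of that relation.
\<close>

type_synonym 'a phase = "'a \<times> 'a"
type_synonym 'a genfun = "'a \<Rightarrow> 'a \<Rightarrow> real \<Rightarrow> real"
type_synonym 'a domains = "real \<Rightarrow> ('a \<times> 'a) set"
type_synonym 'a one_step = "real \<Rightarrow> ('a phase \<times> 'a phase) set"

text \<open>The relations $q_1 = D_2 H(q_0,p_1;h)$ and $p_0 = D_1 H(q_0,p_1;h)$, with $(q_0,p_1)$ in the
  domain \<open>U h\<close>.\<close>

definition type2_relations ::
    "('a::real_inner) domains \<Rightarrow> 'a genfun \<Rightarrow> real \<Rightarrow> 'a \<Rightarrow> 'a \<Rightarrow> 'a \<Rightarrow> 'a \<Rightarrow> bool" where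
  "type2_relations U H h q0 p0 q1 p1 \<longleftrightarrow>
     (q0, p1) \<in> U h \<and>
     (GDERIV (\<lambda>p. H q0 p h) p1 :> q1) \<and>
     (GDERIV (\<lambda>q. H q p1 h) q0 :> p0)"

definition type2_map :: "('a::real_inner) domains \<Rightarrow> 'a genfun \<Rightarrow> 'a one_step" where
  "type2_map U H h = {((q0, p0), (q1, p1)) | q0 p0 q1 p1. type2_relations U H h q0 p0 q1 p1}"

text \<open>The relations $q_0 = -D_1 K(p_0,q_1;h)$ and $p_1 = -D_2 K(p_0,q_1;h)$, with $(p_0,q_1)$ in
  the domain \<open>V h\<close>.\<close>

definition type3_relations ::
    "('a::real_inner) domains \<Rightarrow> 'a genfun \<Rightarrow> real \<Rightarrow> 'a \<Rightarrow> 'a \<Rightarrow> 'a \<Rightarrow> 'a \<Rightarrow> bool" where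
  "type3_relations V K h q0 p0 q1 p1 \<longleftrightarrow>
     (p0, q1) \<in> V h \<and>
     (GDERIV (\<lambda>p. K p q1 h) p0 :> - q0) \<and>
     (GDERIV (\<lambda>q. K p0 q h) q1 :> - p1)"

definition type3_map :: "('a::real_inner) domains \<Rightarrow> 'a genfun \<Rightarrow> 'a one_step" where
  "type3_map V K h = {((q0, p0), (q1, p1)) | q0 p0 q1 p1. type3_relations V K h q0 p0 q1 p1}"

text \<open>The Legendre transform.  Its domain consists of the pairs $(p_0,q_1)$ that occur in the
  relations, and \<open>legendre_args\<close> gives $(q_0,p_1)$ as a function of $(p_0,q_1)$; this is
  meaningful only under \<open>legendre_defined\<close>.\<close>

definition legendre_domain :: "('a::real_inner) domains \<Rightarrow> 'a genfun \<Rightarrow> 'a domains" where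
  "legendre_domain U H h = {(p0, q1) | p0 q1. \<exists>q0 p1. type2_relations U H h q0 p0 q1 p1}"

definition legendre_args ::
    "('a::real_inner) domains \<Rightarrow> 'a genfun \<Rightarrow> real \<Rightarrow> 'a \<times> 'a \<Rightarrow> 'a \<times> 'a" where
  "legendre_args U H h = (\<lambda>(p0, q1). THE (q0, p1). type2_relations U H h q0 p0 q1 p1)"

definition legendre :: "('a::real_inner) domains \<Rightarrow> 'a genfun \<Rightarrow> 'a genfun" where
  "legendre U H p0 q1 h =
     (let (q0, p1) = legendre_args U H h (p0, q1)
      in - (p0 \<bullet> q0) - p1 \<bullet> q1 + H q0 p1 h)"

text \<open>The regularity that makes the Legendre transform a differentiable function on an open set.
  It holds in particular if \<open>H\<close> is $C^2$ on the open set \<open>U h\<close> with everywhere nonsingular Hessian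
  and injective gradient.\<close>

definition legendre_defined :: "('a::real_inner) domains \<Rightarrow> 'a genfun \<Rightarrow> real \<Rightarrow> bool" where
  "legendre_defined U H h \<longleftrightarrow>
     open (U h) \<and>
     (\<lambda>(q0, p1). H q0 p1 h) differentiable_on U h \<and>
     (\<forall>(p0, q1) \<in> legendre_domain U H h. \<exists>!(q0, p1). type2_relations U H h q0 p0 q1 p1) \<and>
     open (legendre_domain U H h) \<and>
     legendre_args U H h differentiable_on legendre_domain U H h"

definition adjoint_type2 :: "'a genfun \<Rightarrow> 'a genfun" where
  "adjoint_type2 H p0 q1 h = - H q1 p0 (- h)"

definition adjoint_domain :: "'a domains \<Rightarrow> 'a domains" where
  "adjoint_domain U h = {(p0, q1) | p0 q1. (q1, p0) \<in> U (- h)}"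

definition adjoint_method :: "'a one_step \<Rightarrow> 'a one_step" where
  "adjoint_method \<Phi> h = (\<Phi> (- h))\<inverse>"

text \<open>Equality of two local maps on a region \<open>W\<close> of phase space: at each point of \<open>W\<close>, either both
  are defined and have the same value or neither is defined.  For \<open>W = UNIV\<close> this is equality of
  the maps together with their domains; smaller \<open>W\<close> give local equality.\<close>

definition agree_on :: "'a set \<Rightarrow> ('a \<times> 'b) set \<Rightarrow> ('a \<times> 'b) set \<Rightarrow> bool" where
  "agree_on W f g \<longleftrightarrow> (\<forall>z\<in>W. f `` {z} = g `` {z})"

definition self_adjoint_method ::
    "real set \<Rightarrow> (real \<Rightarrow> 'a phase set) \<Rightarrow> 'a one_step \<Rightarrow> bool" where
  "self_adjoint_method T W \<Phi> \<longleftrightarrow> (\<forall>h\<in>T. agree_on (W h) (\<Phi> h) (adjoint_method \<Phi> h))"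

definition type3_equivalent ::
    "real set \<Rightarrow> (real \<Rightarrow> ('a::real_inner) phase set) \<Rightarrow>
     'a domains \<Rightarrow> 'a genfun \<Rightarrow> 'a domains \<Rightarrow> 'a genfun \<Rightarrow> bool" where
  "type3_equivalent T W V K V' K' \<longleftrightarrow>
     (\<forall>h\<in>T. agree_on (W h) (type3_map V K h) (type3_map V' K' h))"

definition self_adjoint_type2 ::
    "real set \<Rightarrow> (real \<Rightarrow> ('a::real_inner) phase set) \<Rightarrow> 'a domains \<Rightarrow> 'a genfun \<Rightarrow> bool" where
  "self_adjoint_type2 T W U H \<longleftrightarrow>
     type3_equivalent T W (legendre_domain U H) (legendre U H) (adjoint_domain U) (adjoint_type2 H)"

end

(* The method generated by a Type II function H is also generated by its Legendre transform: the
   derivatives of q0 and p1 with respect to (p0, q1) cancel against the gradient of H.  The map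
   generated by the Type III adjoint of H is the inverse of the Type II map of H at step -h.
   So both notions of self-adjointness compare the same two maps. *)

theory Submission
  imports Defs
begin

text \<open>Two gradients induce the same functional, so their difference is orthogonal to every
  vector, itself included.\<close>

lemma GDERIV_unique:
  assumes "GDERIV f x :> d" "GDERIV f x :> d'"
  shows "d = d'"
proof -
  have "(\<lambda>h. h \<bullet> d) = (\<lambda>h. h \<bullet> d')"
    using assms unfolding gderiv_def by (rule has_derivative_unique)
  then have "h \<bullet> (d - d') = 0" for h
    by (simp add: fun_eq_iff inner_diff_right)
  then show ?thesis
    by (metis inner_eq_zero_iff eq_iff_diff_eq_0)
qed

lemma GDERIV_uminus_iff: "GDERIV (\<lambda>x. - f x) x :> - d \<longleftrightarrow> GDERIV f x :> d"
  using GDERIV_minus[of f x d] GDERIV_minus[of "\<lambda>x. - f x" x "- d"] by auto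

lemma has_derivative_partial_1:
  assumes "(f has_derivative D) (at (x, y))"
  shows "((\<lambda>x. f (x, y)) has_derivative (\<lambda>u. D (u, 0))) (at x)"
  by (rule has_derivative_compose[OF has_derivative_Pair[OF has_derivative_ident has_derivative_const]
        assms])

lemma has_derivative_partial_2:
  assumes "(f has_derivative D) (at (x, y))"
  shows "((\<lambda>y. f (x, y)) has_derivative (\<lambda>v. D (0, v))) (at y)"
  by (rule has_derivative_compose[OF has_derivative_Pair[OF has_derivative_const has_derivative_ident]
        assms])

text \<open>Joint differentiability supplies a linear \<open>D\<close>. Restricting to each axis and
  using uniqueness of derivatives identifies \<open>D (u, 0)\<close> and \<open>D (0, v)\<close>;
  additivity gives the rest.\<close>

lemma has_derivative_from_partial_gradients:
  fixes f :: "'a::real_inner \<Rightarrow> 'b::real_inner \<Rightarrow> real"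
  assumes f: "(\<lambda>(x, y). f x y) differentiable at (x, y)"
    and 1: "GDERIV (\<lambda>x. f x y) x :> a"
    and 2: "GDERIV (\<lambda>y. f x y) y :> b"
  shows "((\<lambda>(x, y). f x y) has_derivative (\<lambda>(u, v). u \<bullet> a + v \<bullet> b)) (at (x, y))"
proof -
  from f obtain D where D: "((\<lambda>(x, y). f x y) has_derivative D) (at (x, y))"
    unfolding differentiable_def by blast
  have "(\<lambda>u. D (u, 0)) = (\<lambda>u. u \<bullet> a)"
    using has_derivative_partial_1[OF D] 1 unfolding gderiv_def
    by (simp add: has_derivative_unique)
  then have D1: "D (u, 0) = u \<bullet> a" for u
    by (rule fun_cong)
  have "(\<lambda>v. D (0, v)) = (\<lambda>v. v \<bullet> b)"
    using has_derivative_partial_2[OF D] 2 unfolding gderiv_def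
    by (simp add: has_derivative_unique)
  then have D2: "D (0, v) = v \<bullet> b" for v
    by (rule fun_cong)
  have "D (u, v) = u \<bullet> a + v \<bullet> b" for u v
    using linear_add[OF has_derivative_linear[OF D], of "(u, 0)" "(0, v)"] D1 D2 by simp
  then have "D = (\<lambda>(u, v). u \<bullet> a + v \<bullet> b)" by auto
  with D show ?thesis by simp
qed

lemma legendre_args_eq:
  assumes "legendre_defined U H h" "type2_relations U H h q0 p0 q1 p1"
  shows "legendre_args U H h (p0, q1) = (q0, p1)"
proof -
  have "\<exists>!(q0, p1). type2_relations U H h q0 p0 q1 p1"
    using assms unfolding legendre_defined_def legendre_domain_def by blast
  then show ?thesis
    unfolding legendre_args_def using assms(2) by (auto intro!: the1_equality)
qed

text \<open>The total derivative is what the chain rule handles; both partial gradients of the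
  Legendre transform are read off from it later. No formula for the derivative of
  \<open>legendre_args\<close> is needed, since its terms drop out.\<close>

lemma legendre_has_derivative:
  assumes L: "legendre_defined U H h" and R: "type2_relations U H h q0 p0 q1 p1"
  shows "((\<lambda>(p, q). legendre U H p q h) has_derivative (\<lambda>(u, v). - (u \<bullet> q0) - v \<bullet> p1))
    (at (p0, q1))"
proof -
  define A where "A = legendre_args U H h"
  have A: "A (p0, q1) = (q0, p1)"
    using legendre_args_eq[OF L R] by (simp add: A_def)
  have "(p0, q1) \<in> legendre_domain U H h"
    using R by (auto simp: legendre_domain_def)
  moreover have "open (legendre_domain U H h)" "A differentiable_on legendre_domain U H h"
    using L by (simp_all add: legendre_defined_def A_def)
  ultimately have "A differentiable at (p0, q1)"
    by (metis differentiable_on_eq_differentiable_at)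
  then obtain A' where A': "(A has_derivative A') (at (p0, q1))"
    unfolding differentiable_def by blast
  have "(q0, p1) \<in> U h" "open (U h)" "(\<lambda>(q, p). H q p h) differentiable_on U h"
    using L R by (simp_all add: legendre_defined_def type2_relations_def)
  then have "(\<lambda>(q, p). H q p h) differentiable at (q0, p1)"
    by (metis differentiable_on_eq_differentiable_at)
  with R have "((\<lambda>(q, p). H q p h) has_derivative (\<lambda>(u, v). u \<bullet> p0 + v \<bullet> q1)) (at (q0, p1))"
    unfolding type2_relations_def
    by (intro has_derivative_from_partial_gradients) auto
  \<comment> \<open>The base point is rewritten as the image of \<open>A\<close>, the shape in which
    the chain rule expects it.\<close>
  then have "((\<lambda>(q, p). H q p h) has_derivative (\<lambda>(u, v). u \<bullet> p0 + v \<bullet> q1))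
      (at (A (p0, q1)))"
    by (simp only: A)
  from has_derivative_compose[OF A' this]
  have dH: "((\<lambda>x. H (fst (A x)) (snd (A x)) h) has_derivative
      (\<lambda>w. fst (A' w) \<bullet> p0 + snd (A' w) \<bullet> q1)) (at (p0, q1))"
    by (simp add: case_prod_beta)
  have fst: "(fst has_derivative fst) (at x)" and snd: "(snd has_derivative snd) (at x)"
    for x :: "'a \<times> 'a"
    by (rule bounded_linear.has_derivative bounded_linear_fst bounded_linear_snd
        has_derivative_ident)+
  note dA = has_derivative_fst[OF A'] has_derivative_snd[OF A']
  have "((\<lambda>x. - (fst x \<bullet> fst (A x)) - snd (A x) \<bullet> snd x + H (fst (A x)) (snd (A x)) h)
      has_derivative (\<lambda>w. - (fst w \<bullet> q0) - snd w \<bullet> p1)) (at (p0, q1))"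
  \<comment> \<open>The product and chain rules give a raw derivative that still contains
    \<open>A'\<close>. In the closing goal its terms cancel by symmetry of the inner
    product.\<close>
  proof (rule has_derivative_eq_rhs)
    show "((\<lambda>x. - (fst x \<bullet> fst (A x)) - snd (A x) \<bullet> snd x + H (fst (A x)) (snd (A x)) h)
      has_derivative (\<lambda>w. - (p0 \<bullet> fst (A' w) + fst w \<bullet> q0)
        - (p1 \<bullet> snd w + snd (A' w) \<bullet> q1) + (fst (A' w) \<bullet> p0 + snd (A' w) \<bullet> q1))) (at (p0, q1))"
      using has_derivative_add[OF has_derivative_diff[OF
            has_derivative_minus[OF has_derivative_inner[OF fst dA(1)]]
            has_derivative_inner[OF dA(2) snd]] dH]
      by (simp add: A)
  qed (simp add: fun_eq_iff inner_commute)
  then show ?thesis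
    by (simp add: legendre_def A_def Let_def case_prod_unfold)
qed

lemma type3_relations_legendre:
  assumes L: "legendre_defined U H h" and R: "type2_relations U H h q0 p0 q1 p1"
  shows "type3_relations (legendre_domain U H) (legendre U H) h q0 p0 q1 p1"
proof -
  note D = legendre_has_derivative[OF L R]
  have "((\<lambda>p. legendre U H p q1 h) has_derivative (\<lambda>u. u \<bullet> - q0)) (at p0)"
    using has_derivative_partial_1[OF D] by simp
  moreover have "((\<lambda>q. legendre U H p0 q h) has_derivative (\<lambda>v. v \<bullet> - p1)) (at q1)"
    using has_derivative_partial_2[OF D] by simp
  ultimately show ?thesis
    using R by (auto simp: type3_relations_def gderiv_def legendre_domain_def)
qed

lemma type3_map_legendre:
  assumes L: "legendre_defined U H h"
  shows "type3_map (legendre_domain U H) (legendre U H) h = type2_map U H h"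
proof -
  have "type2_relations U H h q0 p0 q1 p1"
    if K: "type3_relations (legendre_domain U H) (legendre U H) h q0 p0 q1 p1" for q0 p0 q1 p1
  proof -
    \<comment> \<open>Membership in \<open>legendre_domain\<close> yields some Type II solution over
      \<open>(p0, q1)\<close>. The Legendre transform has one gradient there, so this solution must
      be \<open>(q0, p1)\<close>.\<close>
    from K obtain q0' p1' where R: "type2_relations U H h q0' p0 q1 p1'"
      unfolding type3_relations_def legendre_domain_def by blast
    note K' = type3_relations_legendre[OF L R]
    have "- q0' = - q0" "- p1' = - p1"
      using K K' unfolding type3_relations_def by (blast intro: GDERIV_unique)+
    with R show ?thesis by simp
  qed
  with type3_relations_legendre[OF L] show ?thesis
    unfolding type2_map_def type3_map_def by blast
qed

text \<open>The minus sign in \<open>adjoint_type2\<close> cancels those in the Type III relations.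
  What remains are the Type II relations at step \<open>- h\<close> leading from
  \<open>(q1, p1)\<close> to \<open>(q0, p0)\<close>.\<close>

lemma type3_map_adjoint:
  "type3_map (adjoint_domain U) (adjoint_type2 H) h = adjoint_method (type2_map U H) h"
  unfolding type3_map_def adjoint_method_def type2_map_def type3_relations_def
    type2_relations_def adjoint_domain_def adjoint_type2_def GDERIV_uminus_iff
  by auto

theorem corollary1:
  fixes T :: "real set"
    and U :: "(real ^ 'n) domains"
    and H :: "(real ^ 'n) genfun"
    and W :: "real \<Rightarrow> (real ^ 'n) phase set"
  assumes steps: "\<And>h. h \<in> T \<Longrightarrow> - h \<in> T"
    and legendre: "\<And>h. h \<in> T \<Longrightarrow> legendre_defined U H h"
    and map: "\<And>h. h \<in> T \<Longrightarrow> single_valued (type2_map U H h)"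
    and invertible: "\<And>h. h \<in> T \<Longrightarrow> single_valued ((type2_map U H h)\<inverse>)"
  shows "(self_adjoint_type2 T W U H \<longrightarrow> self_adjoint_method T W (type2_map U H)) \<and>
         (self_adjoint_method T W (type2_map U H) \<longrightarrow> self_adjoint_type2 T W U H)"
  \<comment> \<open>For each \<open>h\<close> in \<open>T\<close>, \<open>legendre\<close> enables
    the conditional rewriting by \<open>type3_map_legendre\<close>; both implications then have
    identical sides.\<close>
  using legendre
  by (simp add: self_adjoint_type2_def self_adjoint_method_def type3_equivalent_def
      type3_map_legendre type3_map_adjoint)

end
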